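(* If an automorphism $\phi$ of a subshift $(\Lambda,\sigma)$ is a simple automorphism, then for every $n\in\mathbb Z$ with $n\neq0$ the dynamical system $(\Lambda,\phi\circ\sigma^n)$ is topologically conjugate to the $n$-th power $(\Lambda,\sigma^n)$ of the subshift $(\Lambda,\sigma)$.
   Context: For a finite alphabet $\Sigma$, $\sigma$ is the left shift on $\Sigma^{\mathbb Z}$; a subshift $(\Lambda,\sigma)$ is a closed $\Lambda\subset\Sigma^{\mathbb Z}$ with $\sigma(\Lambda)=\Lambda$; an automorphism is a homeomorphism of $\Lambda$ commuting with $\sigma$. $(X,f)$ and $(Y,g)$ are topologically conjugate if $hf=gh$ for some homeomorphism $h:X\to Y$. A symbolic matrix over $\Sigma$ is a finite matrix whose entries are finite formal sums (possibly $0$) of elements of $\Sigma$; products are formed formally. A specification is a bijection between sets of symbols; $\mathcal A\overset{\kappa}{\simeq}\mathcal A'$ means that $\mathcal A'$ is obtained from $\mathcal A$ by replacing every symbol $a$ in its components by $\kappa(a)$. A symbolic matrix system $(\mathcal M,I)$ over $\Sigma$ consists of $m(l)\times m(l+1)$ matrices $\mathcal M_{l,l+1}$ (symbolic over $\Sigma$) and $I_{l,l+1}$ (entries in $\{0,1\}$), $l\in\mathbb Z_+=\{0,1,2,\dots\}$, with $I_{l,l+1}\mathcal M_{l+1,l+2}=\mathcal M_{l,l+1}I_{l+1,l+2}$, each row of $I_{l,l+1}$ having at least one $1$ and each column exactly one $1$. It is identified with the $\lambda$-graph system having vertex sets $V_l=\{v^l_1,\dots,v^l_{m(l)}\}$,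 an edge from $v^l_i$ to $v^{l+1}_j$ labeled $\alpha$ for every occurrence of $\alpha$ in $\mathcal M_{l,l+1}(i,j)$, and surjections $\iota:V_{l+1}\to V_l$ with $\iota(v^{l+1}_j)=v^l_i$ iff $I_{l,l+1}(i,j)=1$. Standing assumptions: every vertex emits an edge and every vertex in $V_l$, $l\ge1$, receives one; no two distinct edges have the same source, terminal and label; distinct edges with the same label have distinct terminals. The presented subshift $\Lambda_{\mathcal M}$ consists of the bi-infinite sequences all of whose finite subwords are label words of finite paths (consecutive edges from level $l$ to $l+1$, $l+1$ to $l+2$, ..., starting at any level $l$). An automorphism $\phi_\pi$ of a subshift $\Lambda'$ over $\Sigma'$ is given by a specification $\pi$ of a symbolic matrix system $(\mathcal M,I)$ if $(\mathcal M,I)$ presents $\Lambda'$, $\pi:\Sigma'\to\Sigma'$ is a specification with $\mathcal M_{l,l+1}\overset{\pi}{\simeq}\mathcal M_{l,l+1}$ for all $l\in\mathbb Z_+$, and $\phi_\pi((x_i)_{i\in\mathbb Z})=(\pi(x_i))_{i\in\mathbb Z}$. An automorphism $\phi$ of a subshift $\Lambda$ is simple if there are an automorphism $\phi_\pi$ of a subshift $\Lambda_{\mathcal M}$ given by a specification $\pi$ of a symbolic matrix system $(\mathcal M,I)$, and a topological conjugacy $\psi:\Lambda\to\Lambda_{\mathcal M}$, such that $\phi=\psi^{-1}\circ\phi_\pi\circ\psi$. *)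

theory Defs
  imports "HOL-Analysis.Function_Topology" "HOL-Library.Multiset" "Jordan_Normal_Form.Matrix"
begin

section \<open>Subshifts, automorphisms and topological conjugacy\<close>

definition full_shift :: "'a set \<Rightarrow> (int \<Rightarrow> 'a) topology" where
  "full_shift \<Sigma> = product_topology (\<lambda>_. discrete_topology \<Sigma>) UNIV"

definition shift :: "(int \<Rightarrow> 'a) \<Rightarrow> int \<Rightarrow> 'a" where
  "shift x = (\<lambda>i. x (i + 1))"

text \<open>\<^const>\<open>shift\<close> is a bijection of the type of all two-sided sequences, so its global inverse is
  the inverse shift.\<close>

definition shift_power :: "int \<Rightarrow> (int \<Rightarrow> 'a) \<Rightarrow> int \<Rightarrow> 'a" where
  "shift_power n = (if 0 \<le> n then shift ^^ nat n else inv_into UNIV shift ^^ nat (- n))"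

definition subshift :: "'a set \<Rightarrow> (int \<Rightarrow> 'a) set \<Rightarrow> bool" where
  "subshift \<Sigma> \<Lambda> \<longleftrightarrow> finite \<Sigma> \<and> closedin (full_shift \<Sigma>) \<Lambda> \<and> shift ` \<Lambda> = \<Lambda>"

definition subshift_topology :: "'a set \<Rightarrow> (int \<Rightarrow> 'a) set \<Rightarrow> (int \<Rightarrow> 'a) topology" where
  "subshift_topology \<Sigma> \<Lambda> = subtopology (full_shift \<Sigma>) \<Lambda>"

definition topological_conjugacy ::
  "'x topology \<Rightarrow> ('x \<Rightarrow> 'x) \<Rightarrow> 'y topology \<Rightarrow> ('y \<Rightarrow> 'y) \<Rightarrow> ('x \<Rightarrow> 'y) \<Rightarrow> bool" where
  "topological_conjugacy X f Y g h \<longleftrightarrow>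
     homeomorphic_map X Y h \<and> (\<forall>x\<in>topspace X. h (f x) = g (h x))"

definition topologically_conjugate ::
  "'x topology \<Rightarrow> ('x \<Rightarrow> 'x) \<Rightarrow> 'y topology \<Rightarrow> ('y \<Rightarrow> 'y) \<Rightarrow> bool" where
  "topologically_conjugate X f Y g \<longleftrightarrow> (\<exists>h. topological_conjugacy X f Y g h)"

definition automorphism ::
  "'a set \<Rightarrow> (int \<Rightarrow> 'a) set \<Rightarrow> ((int \<Rightarrow> 'a) \<Rightarrow> int \<Rightarrow> 'a) \<Rightarrow> bool" where
  "automorphism \<Sigma> \<Lambda> \<phi> \<longleftrightarrow>
     homeomorphic_map (subshift_topology \<Sigma> \<Lambda>) (subshift_topology \<Sigma> \<Lambda>) \<phi> \<and>
     (\<forall>x\<in>\<Lambda>. \<phi> (shift x) = shift (\<phi> x))"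

section \<open>Symbolic matrices\<close>

text \<open>A finite formal sum of symbols is a multiset, the empty multiset being the sum \<open>0\<close>.\<close>

definition symbolic_matrix :: "'a set \<Rightarrow> 'a multiset mat \<Rightarrow> bool" where
  "symbolic_matrix \<Sigma> A \<longleftrightarrow> (\<forall>i<dim_row A. \<forall>j<dim_col A. set_mset (A $$ (i, j)) \<subseteq> \<Sigma>)"

definition nat_symbolic_mult :: "nat mat \<Rightarrow> 'a multiset mat \<Rightarrow> 'a multiset mat" where
  "nat_symbolic_mult B A = mat (dim_row B) (dim_col A)
     (\<lambda>(i, j). \<Sum>k<dim_row A. repeat_mset (B $$ (i, k)) (A $$ (k, j)))"

definition symbolic_nat_mult :: "'a multiset mat \<Rightarrow> nat mat \<Rightarrow> 'a multiset mat" where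
  "symbolic_nat_mult A B = mat (dim_row A) (dim_col B)
     (\<lambda>(i, j). \<Sum>k<dim_row B. repeat_mset (B $$ (k, j)) (A $$ (i, k)))"

definition specified_equivalent ::
  "('a \<Rightarrow> 'b) \<Rightarrow> 'a set \<Rightarrow> 'b set \<Rightarrow> 'a multiset mat \<Rightarrow> 'b multiset mat \<Rightarrow> bool" where
  "specified_equivalent \<kappa> \<Sigma> \<Sigma>' A A' \<longleftrightarrow>
     bij_betw \<kappa> \<Sigma> \<Sigma>' \<and> A' = map_mat (image_mset \<kappa>) A"

section \<open>Symbolic matrix systems\<close>

text \<open>\<open>M l\<close> and \<open>I l\<close> are the matrices between levels \<open>l\<close> and \<open>l + 1\<close>.  The vertices at level \<open>l\<close>
  of the associated \<open>\<lambda>\<close>-graph system are the numbers below \<open>m l\<close>.\<close>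

definition symbolic_matrix_system ::
  "'a set \<Rightarrow> (nat \<Rightarrow> nat) \<Rightarrow> (nat \<Rightarrow> 'a multiset mat) \<Rightarrow> (nat \<Rightarrow> nat mat) \<Rightarrow> bool" where
  "symbolic_matrix_system \<Sigma> m M I \<longleftrightarrow>
     finite \<Sigma> \<and>
     (\<forall>l. M l \<in> carrier_mat (m l) (m (Suc l)) \<and> symbolic_matrix \<Sigma> (M l)) \<and>
     (\<forall>l. I l \<in> carrier_mat (m l) (m (Suc l)) \<and>
          (\<forall>i<m l. \<forall>j<m (Suc l). I l $$ (i, j) \<in> {0, 1}) \<and>
          (\<forall>i<m l. \<exists>j<m (Suc l). I l $$ (i, j) = 1) \<and>
          (\<forall>j<m (Suc l). \<exists>!i. i < m l \<and> I l $$ (i, j) = 1)) \<and>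
     (\<forall>l. nat_symbolic_mult (I l) (M (Suc l)) = symbolic_nat_mult (M l) (I (Suc l)))"

definition labeled_edge ::
  "(nat \<Rightarrow> nat) \<Rightarrow> (nat \<Rightarrow> 'a multiset mat) \<Rightarrow> nat \<Rightarrow> nat \<Rightarrow> 'a \<Rightarrow> nat \<Rightarrow> bool" where
  "labeled_edge m M l i a j \<longleftrightarrow> i < m l \<and> j < m (Suc l) \<and> a \<in># M l $$ (i, j)"

text \<open>The standing assumptions on the \<open>\<lambda>\<close>-graph system.  Edges are the occurrences of symbols in
  the entries, so the absence of two distinct edges with equal source, terminal and label is
  a bound on multiplicities; given that bound, an edge is determined by these three data.\<close>

definition standing_assumptions :: "(nat \<Rightarrow> nat) \<Rightarrow> (nat \<Rightarrow> 'a multiset mat) \<Rightarrow> bool" where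
  "standing_assumptions m M \<longleftrightarrow>
     (\<forall>l. \<forall>i<m l. \<exists>a j. labeled_edge m M l i a j) \<and>
     (\<forall>l. \<forall>j<m (Suc l). \<exists>i a. labeled_edge m M l i a j) \<and>
     (\<forall>l. \<forall>i<m l. \<forall>j<m (Suc l). \<forall>a. count (M l $$ (i, j)) a \<le> 1) \<and>
     (\<forall>l i i' a j. labeled_edge m M l i a j \<and> labeled_edge m M l i' a j \<longrightarrow> i = i')"

text \<open>\<open>p k\<close> is the \<open>k\<close>-th vertex of the path, lying at level \<open>l + k\<close>.\<close>

definition path_label ::
  "(nat \<Rightarrow> nat) \<Rightarrow> (nat \<Rightarrow> 'a multiset mat) \<Rightarrow> nat \<Rightarrow> 'a list \<Rightarrow> bool" where
  "path_label m M l w \<longleftrightarrow>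
     (\<exists>p. p 0 < m l \<and> (\<forall>k<length w. labeled_edge m M (l + k) (p k) (w ! k) (p (Suc k))))"

definition presented_subshift ::
  "'a set \<Rightarrow> (nat \<Rightarrow> nat) \<Rightarrow> (nat \<Rightarrow> 'a multiset mat) \<Rightarrow> (int \<Rightarrow> 'a) set" where
  "presented_subshift \<Sigma> m M =
     {x \<in> topspace (full_shift \<Sigma>).
        \<forall>s n. \<exists>l. path_label m M l (map (\<lambda>k. x (s + int k)) [0..<n])}"

section \<open>Simple automorphisms\<close>

definition given_by_specification ::
  "'a set \<Rightarrow> (int \<Rightarrow> 'a) set \<Rightarrow> ((int \<Rightarrow> 'a) \<Rightarrow> int \<Rightarrow> 'a) \<Rightarrow>
     (nat \<Rightarrow> nat) \<Rightarrow> (nat \<Rightarrow> 'a multiset mat) \<Rightarrow> (nat \<Rightarrow> nat mat) \<Rightarrow> ('a \<Rightarrow> 'a) \<Rightarrow> bool" where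
  "given_by_specification \<Sigma> \<Lambda> \<phi> m M I \<pi> \<longleftrightarrow>
     symbolic_matrix_system \<Sigma> m M I \<and> standing_assumptions m M \<and>
     \<Lambda> = presented_subshift \<Sigma> m M \<and>
     automorphism \<Sigma> \<Lambda> \<phi> \<and>
     (\<forall>l. specified_equivalent \<pi> \<Sigma> \<Sigma> (M l) (M l)) \<and>
     (\<forall>x\<in>\<Lambda>. \<phi> x = (\<lambda>i. \<pi> (x i)))"

text \<open>The alphabet of the symbolic matrix system is unrelated to that of \<open>\<Lambda>\<close>; the type \<open>'b\<close> in which
  it lives cannot be quantified existentially and is therefore a parameter.  A theorem that leaves
  \<open>'b\<close> free covers all alphabets.\<close>

definition simple_automorphism ::
  "'b itself \<Rightarrow> 'a set \<Rightarrow> (int \<Rightarrow> 'a) set \<Rightarrow> ((int \<Rightarrow> 'a) \<Rightarrow> int \<Rightarrow> 'a) \<Rightarrow> bool" where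
  "simple_automorphism (_ :: 'b itself) \<Sigma> \<Lambda> \<phi> \<longleftrightarrow>
     automorphism \<Sigma> \<Lambda> \<phi> \<and>
     (\<exists>(\<Sigma>' :: 'b set) \<Lambda>' \<phi>' m M I \<pi> \<psi>.
        given_by_specification \<Sigma>' \<Lambda>' \<phi>' m M I \<pi> \<and>
        topological_conjugacy (subshift_topology \<Sigma> \<Lambda>) shift (subshift_topology \<Sigma>' \<Lambda>') shift \<psi> \<and>
        (\<forall>x\<in>\<Lambda>. \<phi> x = inv_into \<Lambda> \<psi> (\<phi>' (\<psi> x))))"

end

theory Submission
  imports Defs
begin

text \<open>Since \<open>\<pi>\<close> fixes every matrix, a label of an edge may be replaced by any element of its
  \<open>\<pi>\<close>-orbit without changing the endpoints.  Hence for every \<open>k :: int \<Rightarrow> int\<close> the presented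
  subshift is invariant under \<open>x \<mapsto> (\<lambda>i. \<pi>\<^bsup>k i\<^esup> (x i))\<close>, a homeomorphism that need not commute with
  the shift.  For \<open>k i = i div n\<close> we have \<open>k (i + n) = k i + 1\<close>, so it conjugates
  \<open>\<phi>\<^sub>\<pi> \<circ> \<sigma>\<^sup>n\<close> to \<open>\<sigma>\<^sup>n\<close>.\<close>

section \<open>Topological conjugacy as an equivalence relation\<close>

lemma topologically_conjugate_trans:
  assumes "topologically_conjugate X f Y g" "topologically_conjugate Y g Z k"
  shows "topologically_conjugate X f Z k"
proof -
  obtain p q where p: "topological_conjugacy X f Y g p" and q: "topological_conjugacy Y g Z k q"
    using assms by (auto simp: topologically_conjugate_def)
  have "p x \<in> topspace Y" if "x \<in> topspace X" for x
    using p that homeomorphic_imp_surjective_map by (fastforce simp: topological_conjugacy_def)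
  then have "topological_conjugacy X f Z k (q \<circ> p)"
    using p q homeomorphic_map_compose by (auto simp: topological_conjugacy_def)
  then show ?thesis
    by (auto simp: topologically_conjugate_def)
qed

text \<open>The inverse homeomorphism \<open>q\<close> intertwines the maps in the other direction.
  Since \<open>q\<close> undoes \<open>p\<close> only on the space itself, \<open>f (q y)\<close>
  has to stay in \<open>topspace X\<close>, which the second assumption guarantees.\<close>

lemma topologically_conjugate_sym:
  assumes "topologically_conjugate X f Y g" "f ` topspace X \<subseteq> topspace X"
  shows "topologically_conjugate Y g X f"
proof -
  obtain p where p: "homeomorphic_map X Y p" "\<And>x. x \<in> topspace X \<Longrightarrow> p (f x) = g (p x)"
    using assms by (auto simp: topologically_conjugate_def topological_conjugacy_def)
  then obtain q where q: "homeomorphic_maps X Y p q"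
    using homeomorphic_map_maps by blast
  have "q (g y) = f (q y)" if "y \<in> topspace Y" for y
  proof -
    have y: "q y \<in> topspace X" "p (q y) = y"
      using q that by (auto simp: homeomorphic_maps_def continuous_map_def)
    then have "q (p (f (q y))) = f (q y)"
      using q assms(2) by (auto simp: homeomorphic_maps_def)
    then show ?thesis
      using p(2) y by simp
  qed
  moreover have "homeomorphic_map Y X q"
    using q homeomorphic_maps_map by blast
  ultimately show ?thesis
    by (auto simp: topologically_conjugate_def topological_conjugacy_def)
qed

section \<open>Integer powers of the shift\<close>

lemma shift_power_apply: "shift_power n x i = x (i + n)"
proof -
  have inv: "inv_into UNIV shift x = (\<lambda>i. x (i - 1))" for x :: "int \<Rightarrow> 'a"
  proof (rule inv_f_eq)
    show "inj (shift :: (int \<Rightarrow> 'a) \<Rightarrow> int \<Rightarrow> 'a)"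
    proof (rule injI)
      fix x y :: "int \<Rightarrow> 'a"
      assume "shift x = shift y"
      then have "x (i - 1 + 1) = y (i - 1 + 1)" for i
        unfolding shift_def by metis
      then show "x = y"
        by auto
    qed
  qed (simp add: shift_def)
  have "(shift ^^ k) x i = x (i + int k)" for k
    by (induction k arbitrary: i) (simp_all add: shift_def algebra_simps)
  moreover have "(inv_into UNIV shift ^^ k) x i = x (i - int k)" for k
    by (induction k arbitrary: i) (simp_all add: inv algebra_simps)
  ultimately show ?thesis
    by (simp add: shift_power_def)
qed

lemma shift_power_0: "shift_power 0 x = x"
  by (simp add: fun_eq_iff shift_power_apply)

lemma shift_shift_power: "shift (shift_power n x) = shift_power (n + 1) x"
  by (simp add: fun_eq_iff shift_power_apply shift_def algebra_simps)

lemma shift_inject: "shift x = shift y \<longleftrightarrow> x = y"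
proof
  assume "shift x = shift y"
  then have "shift_power (- 1) (shift x) = shift_power (- 1) (shift y)"
    by simp
  then show "x = y"
    by (simp add: fun_eq_iff shift_power_apply shift_def)
qed simp

text \<open>Induction over the integers in both directions from \<open>0\<close>. Going down uses
  that \<open>shift\<close> is onto \<open>\<Lambda>\<close>: the preimage found in
  \<open>\<Lambda>\<close> is the wanted point because \<open>shift\<close> is injective on all
  sequences.\<close>

lemma shift_power_in:
  assumes "shift ` \<Lambda> = \<Lambda>" "x \<in> \<Lambda>"
  shows "shift_power n x \<in> \<Lambda>"
proof (induction n rule: int_induct[where k = 0])
  case base
  then show ?case
    using assms by (simp add: shift_power_0)
next
  case (step1 i)
  then show ?case
    using assms shift_shift_power by (metis imageI)
next
  case (step2 i)
  then obtain y where "y \<in> \<Lambda>" "shift y = shift (shift_power (i - 1) x)"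
    using assms by (metis shift_shift_power diff_add_cancel imageE)
  then show ?case
    by (simp add: shift_inject)
qed

lemma commutes_shift_power:
  assumes "shift ` \<Lambda> = \<Lambda>" "x \<in> \<Lambda>" "\<And>x. x \<in> \<Lambda> \<Longrightarrow> \<psi> (shift x) = shift (\<psi> x)"
  shows "\<psi> (shift_power n x) = shift_power n (\<psi> x)"
proof (induction n rule: int_induct[where k = 0])
  case base
  then show ?case
    by (simp add: shift_power_0)
next
  case (step1 i)
  then show ?case
    using assms(3) shift_power_in[OF assms(1,2)] by (metis shift_shift_power)
next
  case (step2 i)
  \<comment> \<open>Downwards, both sides are compared after one more shift, which is then
    cancelled.\<close>
  have "shift (\<psi> (shift_power (i - 1) x)) = \<psi> (shift_power i x)"
    using assms(3)[OF shift_power_in[OF assms(1,2)], of "i - 1"] by (simp add: shift_shift_power)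
  also have "\<dots> = shift (shift_power (i - 1) (\<psi> x))"
    using step2 by (simp add: shift_shift_power)
  finally show ?case
    by (simp add: shift_inject)
qed

section \<open>Permutations of the alphabet that respect the labeled graph\<close>

text \<open>Such a permutation keeps both endpoints of every edge, so it acts trivially on vertices.
  Edges rather than matrices are compared because \<open>path_label\<close> speaks of edges.\<close>

definition label_symmetry ::
  "'a set \<Rightarrow> (nat \<Rightarrow> nat) \<Rightarrow> (nat \<Rightarrow> 'a multiset mat) \<Rightarrow> ('a \<Rightarrow> 'a) \<Rightarrow> bool" where
  "label_symmetry \<Sigma> m M \<kappa> \<longleftrightarrow> bij_betw \<kappa> \<Sigma> \<Sigma> \<and>
     (\<forall>l i j. \<forall>a\<in>\<Sigma>. labeled_edge m M l i (\<kappa> a) j \<longleftrightarrow> labeled_edge m M l i a j)"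

lemma label_symmetry_in: "label_symmetry \<Sigma> m M \<kappa> \<Longrightarrow> a \<in> \<Sigma> \<Longrightarrow> \<kappa> a \<in> \<Sigma>"
  by (auto simp: label_symmetry_def bij_betw_def)

lemma label_symmetry_inv_into:
  assumes "label_symmetry \<Sigma> m M \<kappa>"
  shows "label_symmetry \<Sigma> m M (inv_into \<Sigma> \<kappa>)"
proof -
  have bij: "bij_betw \<kappa> \<Sigma> \<Sigma>"
    using assms by (simp add: label_symmetry_def)
  then have inv: "bij_betw (inv_into \<Sigma> \<kappa>) \<Sigma> \<Sigma>"
    by (rule bij_betw_inv_into)
  have "labeled_edge m M l i (inv_into \<Sigma> \<kappa> a) j \<longleftrightarrow> labeled_edge m M l i a j"
    if "a \<in> \<Sigma>" for l i a j
  proof -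
    have "inv_into \<Sigma> \<kappa> a \<in> \<Sigma>"
      using inv that by (rule bij_betw_apply)
    then have "labeled_edge m M l i (\<kappa> (inv_into \<Sigma> \<kappa> a)) j
        \<longleftrightarrow> labeled_edge m M l i (inv_into \<Sigma> \<kappa> a) j"
      using assms unfolding label_symmetry_def by blast
    then show ?thesis
      using bij_betw_inv_into_right[OF bij that] by simp
  qed
  then show ?thesis
    using inv by (simp add: label_symmetry_def)
qed

lemma label_symmetry_funpow:
  assumes "label_symmetry \<Sigma> m M \<kappa>"
  shows "label_symmetry \<Sigma> m M (\<kappa> ^^ k)"
proof (induction k)
  case 0
  then show ?case
    using bij_betw_id by (simp add: label_symmetry_def id_def)
next
  case (Suc k)
  then show ?case
    using assms label_symmetry_in[OF Suc] bij_betw_trans[of "\<kappa> ^^ k" \<Sigma> \<Sigma> \<kappa> \<Sigma>]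
    by (simp add: label_symmetry_def comp_def)
qed

lemma label_symmetry_specification:
  assumes sys: "symbolic_matrix_system \<Sigma> m M I"
    and spec: "\<And>l. specified_equivalent \<pi> \<Sigma> \<Sigma> (M l) (M l)"
  shows "label_symmetry \<Sigma> m M \<pi>"
proof -
  have bij: "bij_betw \<pi> \<Sigma> \<Sigma>"
    using spec by (simp add: specified_equivalent_def)
  have "\<pi> a \<in># M l $$ (i, j) \<longleftrightarrow> a \<in># M l $$ (i, j)"
    if "i < m l" "j < m (Suc l)" "a \<in> \<Sigma>" for l i j a
  proof -
    have dim: "dim_row (M l) = m l" "dim_col (M l) = m (Suc l)"
      and "symbolic_matrix \<Sigma> (M l)"
      using sys unfolding symbolic_matrix_system_def by (blast dest: carrier_matD)+
    then have sub: "set_mset (M l $$ (i, j)) \<subseteq> \<Sigma>"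
      using that by (simp add: symbolic_matrix_def)
    have "M l $$ (i, j) = map_mat (image_mset \<pi>) (M l) $$ (i, j)"
      using spec[of l] by (simp add: specified_equivalent_def)
    then have "set_mset (M l $$ (i, j)) = \<pi> ` set_mset (M l $$ (i, j))"
      using that dim by (metis index_map_mat(1) set_image_mset)
    then show ?thesis
      using bij sub that(3) by (metis bij_betw_imp_inj_on inj_on_image_mem_iff)
  qed
  then show ?thesis
    using bij by (auto simp: label_symmetry_def labeled_edge_def)
qed

text \<open>Meaningful only on \<open>\<Sigma>\<close>, and only if \<open>\<pi>\<close> permutes \<open>\<Sigma>\<close>.\<close>

definition int_funpow :: "'a set \<Rightarrow> ('a \<Rightarrow> 'a) \<Rightarrow> int \<Rightarrow> 'a \<Rightarrow> 'a" where
  "int_funpow \<Sigma> \<pi> k = (if 0 \<le> k then \<pi> ^^ nat k else inv_into \<Sigma> \<pi> ^^ nat (- k))"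

lemma label_symmetry_int_funpow:
  "label_symmetry \<Sigma> m M \<pi> \<Longrightarrow> label_symmetry \<Sigma> m M (int_funpow \<Sigma> \<pi> k)"
  by (simp add: int_funpow_def label_symmetry_funpow label_symmetry_inv_into)

lemma int_funpow_add_1:
  assumes "bij_betw \<pi> \<Sigma> \<Sigma>" "a \<in> \<Sigma>"
  shows "int_funpow \<Sigma> \<pi> k (\<pi> a) = int_funpow \<Sigma> \<pi> (k + 1) a"
proof (cases "0 \<le> k")
  case True
  then have "nat (k + 1) = Suc (nat k)"
    by simp
  then show ?thesis
    using True by (simp add: int_funpow_def funpow_swap1)
next
  case False
  \<comment> \<open>One inverse factor is split off to cancel \<open>\<pi>\<close>. For
    \<open>k = -1\<close> none remains, in agreement with the zeroth power of
    \<open>\<pi>\<close>.\<close>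
  then have "nat (- k) = Suc (nat (- 1 - k))"
    by simp
  moreover have "inv_into \<Sigma> \<pi> (\<pi> a) = a"
    using assms by (rule bij_betw_inv_into_left)
  ultimately show ?thesis
    using False by (simp add: int_funpow_def funpow_swap1 algebra_simps)
qed

section \<open>Relabeling each coordinate by its own symmetry\<close>

text \<open>The vertices of a path carrying a subword of \<open>x\<close> also carry the relabeled
  subword. Because no edge changes its endpoints, the symmetries at different coordinates may be
  chosen independently.\<close>

lemma presented_subshift_relabel:
  assumes "\<And>i. label_symmetry \<Sigma> m M (\<kappa> i)" "x \<in> presented_subshift \<Sigma> m M"
  shows "(\<lambda>i. \<kappa> i (x i)) \<in> presented_subshift \<Sigma> m M"
proof -
  have x: "x i \<in> \<Sigma>" for i
    using assms(2) by (auto simp: presented_subshift_def full_shift_def)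
  have "labeled_edge m M l p (\<kappa> i (x i)) q \<longleftrightarrow> labeled_edge m M l p (x i) q" for l p i q
    using assms(1) x by (simp add: label_symmetry_def)
  then show ?thesis
    using assms x label_symmetry_in[OF assms(1)]
    by (auto simp: presented_subshift_def full_shift_def path_label_def)
qed

lemma topspace_subshift_topology:
  assumes "\<Lambda> \<subseteq> topspace (full_shift \<Sigma>)"
  shows "topspace (subshift_topology \<Sigma> \<Lambda>) = \<Lambda>"
  using assms by (auto simp: subshift_topology_def)

lemma topspace_presented_subshift:
  "topspace (subshift_topology \<Sigma> (presented_subshift \<Sigma> m M)) = presented_subshift \<Sigma> m M"
  by (rule topspace_subshift_topology) (auto simp: presented_subshift_def)

text \<open>Each coordinate of the image depends on a single coordinate of \<open>x\<close>, through
  a map of discrete spaces.\<close>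

lemma continuous_map_relabel:
  assumes "\<And>i. label_symmetry \<Sigma> m M (\<kappa> i)"
  defines "X \<equiv> subshift_topology \<Sigma> (presented_subshift \<Sigma> m M)"
  shows "continuous_map X X (\<lambda>x i. \<kappa> i (x i))"
proof -
  have "continuous_map (full_shift \<Sigma>) (discrete_topology \<Sigma>) (\<lambda>x. \<kappa> i (x i))" for i
  proof -
    have "continuous_map (full_shift \<Sigma>) (discrete_topology \<Sigma>) (\<lambda>x. x i)"
      unfolding full_shift_def by (rule continuous_map_product_projection) simp
    moreover have "continuous_map (discrete_topology \<Sigma>) (discrete_topology \<Sigma>) (\<kappa> i)"
      using label_symmetry_in[OF assms(1)] by auto
    ultimately have "continuous_map (full_shift \<Sigma>) (discrete_topology \<Sigma>) (\<kappa> i \<circ> (\<lambda>x. x i))"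
      by (rule continuous_map_compose)
    then show ?thesis
      by (simp add: comp_def)
  qed
  then have "continuous_map (full_shift \<Sigma>) (full_shift \<Sigma>) (\<lambda>x i. \<kappa> i (x i))"
    \<comment> \<open>Only the codomain is unfolded into a product, for the componentwise
      criterion.\<close>
    by (subst (2) full_shift_def) (simp add: continuous_map_componentwise_UNIV)
  then show ?thesis
    using presented_subshift_relabel[where \<kappa> = \<kappa>, OF assms(1)] unfolding X_def subshift_topology_def
    by (auto simp: continuous_map_in_subtopology continuous_map_from_subtopology)
qed

text \<open>The inverse is again a relabeling, by the inverse permutations, so continuity in both
  directions is the same statement.\<close>

lemma homeomorphic_map_relabel:
  assumes "\<And>i. label_symmetry \<Sigma> m M (\<kappa> i)"
  defines "X \<equiv> subshift_topology \<Sigma> (presented_subshift \<Sigma> m M)"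
  shows "homeomorphic_map X X (\<lambda>x i. \<kappa> i (x i))"
proof -
  let ?inv = "\<lambda>i. inv_into \<Sigma> (\<kappa> i)"
  have x: "x i \<in> \<Sigma>" if "x \<in> topspace X" for x i
    using that
    unfolding X_def topspace_presented_subshift by (auto simp: presented_subshift_def full_shift_def)
  have bij: "bij_betw (\<kappa> i) \<Sigma> \<Sigma>" for i
    using assms(1) by (simp add: label_symmetry_def)
  have "homeomorphic_maps X X (\<lambda>x i. \<kappa> i (x i)) (\<lambda>x i. ?inv i (x i))"
    unfolding homeomorphic_maps_def
    using continuous_map_relabel[where \<kappa> = \<kappa>, OF assms(1)]
      continuous_map_relabel[where \<kappa> = ?inv, OF label_symmetry_inv_into[OF assms(1)]]
      x bij_betw_inv_into_left[OF bij] bij_betw_inv_into_right[OF bij]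
    by (simp add: X_def)
  then show ?thesis
    using homeomorphic_map_maps by blast
qed

section \<open>The conjugacy for automorphisms given by a specification\<close>

lemma topologically_conjugate_specification:
  assumes "given_by_specification \<Sigma> \<Lambda> \<phi> m M I \<pi>" "n \<noteq> 0"
    and inv: "\<And>x. x \<in> \<Lambda> \<Longrightarrow> shift_power n x \<in> \<Lambda>"
  shows "topologically_conjugate (subshift_topology \<Sigma> \<Lambda>) (\<phi> \<circ> shift_power n)
    (subshift_topology \<Sigma> \<Lambda>) (shift_power n)"
proof -
  have \<Lambda>: "\<Lambda> = presented_subshift \<Sigma> m M" and \<phi>: "\<And>x. x \<in> \<Lambda> \<Longrightarrow> \<phi> x = (\<lambda>i. \<pi> (x i))"
    using assms(1) by (auto simp: given_by_specification_def)
  have sym: "label_symmetry \<Sigma> m M \<pi>"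
    by (rule label_symmetry_specification[where I = I])
      (use assms(1) in \<open>simp_all add: given_by_specification_def\<close>)
  \<comment> \<open>At \<open>i\<close>, both sides of the conjugacy equation apply a power of
    \<open>\<pi>\<close> to \<open>x (i + n)\<close>: the exponent is \<open>i div n + 1\<close> on
    the left and \<open>(i + n) div n\<close> on the right.\<close>
  let ?h = "\<lambda>x i. int_funpow \<Sigma> \<pi> (i div n) (x i)"
  have "?h ((\<phi> \<circ> shift_power n) x) = shift_power n (?h x)" if "x \<in> \<Lambda>" for x
  proof
    fix i
    have "x (i + n) \<in> \<Sigma>"
      using that by (auto simp: \<Lambda> presented_subshift_def full_shift_def)
    moreover have "bij_betw \<pi> \<Sigma> \<Sigma>"
      using sym by (simp add: label_symmetry_def)
    \<comment> \<open>Integer division rounds down, so this covers negative \<open>n\<close> as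
      well.\<close>
    moreover have "(i + n) div n = i div n + 1"
      using \<open>n \<noteq> 0\<close> by simp
    ultimately show "?h ((\<phi> \<circ> shift_power n) x) i = shift_power n (?h x) i"
      using \<phi>[OF inv[OF that]] by (simp add: shift_power_apply int_funpow_add_1)
  qed
  moreover have "homeomorphic_map (subshift_topology \<Sigma> \<Lambda>) (subshift_topology \<Sigma> \<Lambda>) ?h"
    unfolding \<Lambda> using label_symmetry_int_funpow[OF sym] by (rule homeomorphic_map_relabel)
  moreover have "topspace (subshift_topology \<Sigma> \<Lambda>) = \<Lambda>"
    unfolding \<Lambda> by (rule topspace_presented_subshift)
  ultimately have "topological_conjugacy (subshift_topology \<Sigma> \<Lambda>) (\<phi> \<circ> shift_power n)
      (subshift_topology \<Sigma> \<Lambda>) (shift_power n) ?h"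
    by (simp only: topological_conjugacy_def) blast
  then show ?thesis
    unfolding topologically_conjugate_def by blast
qed

section \<open>Transport along the conjugacy \<open>\<psi>\<close>\<close>

theorem theorem8p2:
  fixes \<Sigma> :: "'a set" and \<Lambda> :: "(int \<Rightarrow> 'a) set" and \<phi> :: "(int \<Rightarrow> 'a) \<Rightarrow> int \<Rightarrow> 'a"
  assumes "subshift \<Sigma> \<Lambda>"
    and "simple_automorphism TYPE('b) \<Sigma> \<Lambda> \<phi>"
  shows "\<forall>n::int. n \<noteq> 0 \<longrightarrow>
    topologically_conjugate (subshift_topology \<Sigma> \<Lambda>) (\<phi> \<circ> shift_power n)
      (subshift_topology \<Sigma> \<Lambda>) (shift_power n)"
proof (intro allI impI)
  fix n :: int
  assume "n \<noteq> 0"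
  obtain \<Sigma>' :: "'b set" and \<Lambda>' \<phi>' m M I \<pi> \<psi> where
    spec: "given_by_specification \<Sigma>' \<Lambda>' \<phi>' m M I \<pi>" and
    conj: "topological_conjugacy (subshift_topology \<Sigma> \<Lambda>) shift (subshift_topology \<Sigma>' \<Lambda>') shift \<psi>" and
    \<phi>: "\<And>x. x \<in> \<Lambda> \<Longrightarrow> \<phi> x = inv_into \<Lambda> \<psi> (\<phi>' (\<psi> x))"
    using assms(2) unfolding simple_automorphism_def by blast
  let ?X = "subshift_topology \<Sigma> \<Lambda>" and ?Y = "subshift_topology \<Sigma>' \<Lambda>'"
  have X: "topspace ?X = \<Lambda>"
    using assms(1) by (simp add: subshift_def closedin_subset topspace_subshift_topology)
  have Y: "topspace ?Y = \<Lambda>'"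
    using spec by (simp add: given_by_specification_def topspace_presented_subshift)
  have inv: "shift ` \<Lambda> = \<Lambda>"
    using assms(1) by (simp add: subshift_def)
  have hom: "homeomorphic_map ?X ?Y \<psi>" and comm: "\<And>x. x \<in> \<Lambda> \<Longrightarrow> \<psi> (shift x) = shift (\<psi> x)"
    using conj X by (auto simp: topological_conjugacy_def)
  have surj: "\<psi> ` \<Lambda> = \<Lambda>'"
    using homeomorphic_imp_surjective_map[OF hom] X Y by simp
  have power: "\<psi> (shift_power n x) = shift_power n (\<psi> x)" if "x \<in> \<Lambda>" for x
    using inv that comm by (rule commutes_shift_power)
  \<comment> \<open>Invariance of \<open>\<Lambda>'\<close> is inherited from
    \<open>\<Lambda>\<close> through \<open>\<psi>\<close>.\<close>
  have inv': "shift_power n y \<in> \<Lambda>'" if y: "y \<in> \<Lambda>'" for y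
  proof -
    obtain x where x: "x \<in> \<Lambda>" "y = \<psi> x"
      using y surj by blast
    then have "\<psi> (shift_power n x) \<in> \<Lambda>'"
      using surj shift_power_in[OF inv] by blast
    then show ?thesis
      using x power by simp
  qed
  have "\<phi>' ` \<Lambda>' = \<Lambda>'"
    using spec homeomorphic_imp_surjective_map[of ?Y ?Y \<phi>'] unfolding Y
    by (meson given_by_specification_def automorphism_def)
  \<comment> \<open>\<open>inv_into \<Lambda> \<psi>\<close> yields a genuine preimage only for
    points of \<open>\<psi>\<close> \<Lambda>\<open>, hence the appeal to\<close>\<phi>'
    \<open>\<Lambda>' = \<Lambda>'\<close>.\<close>
  have \<psi>\<phi>: "\<psi> (\<phi> x) = \<phi>' (\<psi> x)" if "x \<in> \<Lambda>" for x
  proof -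
    have "\<phi>' (\<psi> x) \<in> \<psi> ` \<Lambda>"
      using \<open>\<phi>' ` \<Lambda>' = \<Lambda>'\<close> surj that by blast
    then show ?thesis
      by (simp add: \<phi>[OF that] f_inv_into_f)
  qed
  \<comment> \<open>Three conjugacies are chained: \<open>\<psi>\<close> leads to
    \<open>\<Lambda>'\<close>, the relabeling there removes \<open>\<phi>'\<close>, and the inverse
    of \<open>\<psi>\<close> leads back to \<open>\<Lambda>\<close>.\<close>
  have "topologically_conjugate ?X (\<phi> \<circ> shift_power n) ?Y (\<phi>' \<circ> shift_power n)"
    unfolding topologically_conjugate_def topological_conjugacy_def
    using hom X power \<psi>\<phi> shift_power_in[OF inv] by auto
  then have "topologically_conjugate ?X (\<phi> \<circ> shift_power n) ?Y (shift_power n)"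
    using topologically_conjugate_specification[OF spec \<open>n \<noteq> 0\<close> inv']
    by (rule topologically_conjugate_trans)
  moreover have "topologically_conjugate ?X (shift_power n) ?Y (shift_power n)"
    unfolding topologically_conjugate_def topological_conjugacy_def
    using hom X power by auto
  then have "topologically_conjugate ?Y (shift_power n) ?X (shift_power n)"
    by (rule topologically_conjugate_sym) (use X shift_power_in[OF inv] in auto)
  ultimately show "topologically_conjugate ?X (\<phi> \<circ> shift_power n) ?X (shift_power n)"
    by (rule topologically_conjugate_trans)
qed

end
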